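(* Let $G$ be a locally compact Hausdorff topological group, let $n\in\mathbb N$, and suppose $G$ is of type $\mathrm C_n$. Then $\Sigma^n_{\mathrm{top}}(G)$ contains all characters $\chi\colon G\to\mathbb R$ that do not vanish on the center $\operatorname Z(G)$.
   Context: $\mathbb N$ contains $0$. A character on $G$ is a continuous homomorphism $\chi\colon G\to\mathbb R$; $G_\chi:=\{g\in G\mid\chi(g)\ge0\}$. "Does not vanish on $\operatorname Z(G)$" means $\chi(z)\ne0$ for some $z\in\operatorname Z(G)$. For a set $S$, $\mathrm E S$ is the simplicial set with $n$-simplices $S^{n+1}$, the $i$-th face (degeneracy) map deleting (doubling) the $i$-th entry. $\mathcal C(G)$ is the poset of compact subsets of $G$ ordered by inclusion. For $C\in\mathcal C(G)$, $G_\chi\cdot\mathrm E C\subseteq \mathrm E G$ is the simplicial subset of all simplices $(gx_0,\dots,gx_k)$ with $g\in G_\chi$, $x_i\in C$; $G\cdot\mathrm E C$ is defined the same way with $g\in G$. A filtration $(X_\alpha)_{\alpha\in A}$ of a connected simplicial set $X$ over a directed poset $A$ (simplicial subsets, increasing in $\alpha$, with union $X$) is essentially $n$-connected if for a vertex $x\in X$ (the choice is immaterial), every $k$ with $0\le k\le n$ and every $\alpha$ with $x\in X_\alpha$, there is $\beta\ge\alpha$ such that $\pi_k(X_\alpha,x)\to\pi_k(X_\beta,x)$ is trivial (homotopy groups are those of geometric realizations); essentially $(-1)$-connected is a vacuous condition. $G$ is of type $\mathrm C_n$ if the filtration $(G\cdot\mathrm E C)_{C\in\mathcal C(G)}$ of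 $\mathrm E G$ is essentially $(n-1)$-connected. $\Sigma^n_{\mathrm{top}}(G)$ is the set of characters $\chi$ for which the filtration $(G_\chi\cdot \mathrm E C)_{C\in\mathcal C(G)}$ of $\mathrm E G$ is essentially $(n-1)$-connected. *)

theory Defs
  imports "HOL-Analysis.Analysis" "HOL-Algebra.Group" "HOL-Homology.Homology"
begin

section \<open>Topological groups and characters\<close>

locale topological_group = group G for G (structure) +
  fixes T :: "'a topology"
  assumes topspace_eq: "topspace T = carrier G"
    and continuous_mult: "continuous_map (prod_topology T T) T (\<lambda>(x, y). x \<otimes> y)"
    and continuous_inv: "continuous_map T T (\<lambda>x. inv x)"

definition group_center :: "('a, 'b) monoid_scheme \<Rightarrow> 'a set" where
  "group_center G = {z \<in> carrier G. \<forall>g\<in>carrier G. z \<otimes>\<^bsub>G\<^esub> g = g \<otimes>\<^bsub>G\<^esub> z}"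

text \<open>Only the values of a character on the carrier matter; its values elsewhere are arbitrary.\<close>

definition character :: "('a, 'b) monoid_scheme \<Rightarrow> 'a topology \<Rightarrow> ('a \<Rightarrow> real) \<Rightarrow> bool" where
  "character G T chi \<longleftrightarrow> continuous_map T euclideanreal chi \<and>
     (\<forall>x\<in>carrier G. \<forall>y\<in>carrier G. chi (x \<otimes>\<^bsub>G\<^esub> y) = chi x + chi y)"

definition char_halfspace :: "('a, 'b) monoid_scheme \<Rightarrow> ('a \<Rightarrow> real) \<Rightarrow> 'a set" where
  "char_halfspace G chi = {g \<in> carrier G. 0 \<le> chi g}"


section \<open>Simplicial sets\<close>

text \<open>
  \<open>face X n i\<close> is the \<open>i\<close>-th face map from the \<open>(n+1)\<close>-simplices to the \<open>n\<close>-simplices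
  (\<open>i \<le> n + 1\<close>), and \<open>degen X n i\<close> is the \<open>i\<close>-th degeneracy map from the \<open>n\<close>-simplices to the
  \<open>(n+1)\<close>-simplices (\<open>i \<le> n\<close>).
\<close>

record 's sset =
  simplices :: "nat \<Rightarrow> 's set"
  face :: "nat \<Rightarrow> nat \<Rightarrow> 's \<Rightarrow> 's"
  degen :: "nat \<Rightarrow> nat \<Rightarrow> 's \<Rightarrow> 's"

definition simplicial_set :: "'s sset \<Rightarrow> bool" where
  "simplicial_set X \<longleftrightarrow>
     (\<forall>n. \<forall>i\<le>Suc n. \<forall>x\<in>simplices X (Suc n). face X n i x \<in> simplices X n) \<and>
     (\<forall>n. \<forall>i\<le>n. \<forall>x\<in>simplices X n. degen X n i x \<in> simplices X (Suc n)) \<and>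
     (\<forall>n i j. \<forall>x\<in>simplices X (n + 2). i < j \<and> j \<le> n + 2 \<longrightarrow>
        face X n i (face X (Suc n) j x) = face X n (j - 1) (face X (Suc n) i x)) \<and>
     (\<forall>n i j. \<forall>x\<in>simplices X n. i \<le> j \<and> j \<le> n \<longrightarrow>
        degen X (Suc n) i (degen X n j x) = degen X (Suc n) (Suc j) (degen X n i x)) \<and>
     (\<forall>n i j. \<forall>x\<in>simplices X (Suc n). i < j \<and> j \<le> Suc n \<longrightarrow>
        face X (Suc n) i (degen X (Suc n) j x) = degen X n (j - 1) (face X n i x)) \<and>
     (\<forall>n i. \<forall>x\<in>simplices X n. i \<le> n \<longrightarrow>
        face X n i (degen X n i x) = x \<and> face X n (Suc i) (degen X n i x) = x) \<and>
     (\<forall>n i j. \<forall>x\<in>simplices X (Suc n). Suc j < i \<and> i \<le> n + 2 \<longrightarrow>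
        face X (Suc n) i (degen X (Suc n) j x) = degen X n j (face X n (i - 1) x))"

definition simplicial_subset :: "'s sset \<Rightarrow> 's sset \<Rightarrow> bool" where
  "simplicial_subset Y X \<longleftrightarrow>
     face Y = face X \<and> degen Y = degen X \<and>
     (\<forall>n. simplices Y n \<subseteq> simplices X n) \<and>
     (\<forall>n. \<forall>i\<le>Suc n. \<forall>x\<in>simplices Y (Suc n). face X n i x \<in> simplices Y n) \<and>
     (\<forall>n. \<forall>i\<le>n. \<forall>x\<in>simplices Y n. degen X n i x \<in> simplices Y (Suc n))"

text \<open>An \<open>n\<close>-simplex of \<open>E S\<close> is a list of length \<open>n + 1\<close> with entries in \<open>S\<close>.\<close>

definition delete_entry :: "nat \<Rightarrow> 'a list \<Rightarrow> 'a list" where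
  "delete_entry i xs = take i xs @ drop (Suc i) xs"

definition double_entry :: "nat \<Rightarrow> 'a list \<Rightarrow> 'a list" where
  "double_entry i xs = take (Suc i) xs @ drop i xs"

definition E :: "'a set \<Rightarrow> 'a list sset" where
  "E S = \<lparr> simplices = (\<lambda>n. {xs. length xs = Suc n \<and> set xs \<subseteq> S}),
           face = (\<lambda>n. delete_entry), degen = (\<lambda>n. double_entry) \<rparr>"

text \<open>\<open>translates G H C\<close> is the simplicial subset \<open>H \<cdot> E C\<close> of \<open>E (carrier G)\<close>.\<close>

definition translates :: "('a, 'b) monoid_scheme \<Rightarrow> 'a set \<Rightarrow> 'a set \<Rightarrow> 'a list sset" where
  "translates G H C =
     (E (carrier G)) \<lparr> simplices :=
        (\<lambda>n. {map (\<lambda>x. g \<otimes>\<^bsub>G\<^esub> x) xs | g xs. g \<in> H \<and> xs \<in> simplices (E C) n}) \<rparr>"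


section \<open>Geometric realization\<close>

text \<open>
  The realization is the quotient of the disjoint union of the spaces
  \<open>simplices X n \<times> standard_simplex n\<close>, with \<open>simplices X n\<close> discrete, by the equivalence relation
  generated by the face and degeneracy relations.  A point of the disjoint union is a triple
  \<open>(n, x, t)\<close>; the library's \<^const>\<open>simplical_face\<close> is the \<open>i\<close>-th coface map on barycentric
  coordinates, and \<open>codegeneracy\<close> is the \<open>i\<close>-th codegeneracy map.
\<close>

definition codegeneracy :: "nat \<Rightarrow> (nat \<Rightarrow> real) \<Rightarrow> nat \<Rightarrow> real" where
  "codegeneracy i t = (\<lambda>j. if j < i then t j else if j = i then t i + t (Suc i) else t (Suc j))"

definition prerealization :: "'s sset \<Rightarrow> (nat \<times> 's \<times> (nat \<Rightarrow> real)) topology" where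
  "prerealization X =
     sum_topology (\<lambda>n. prod_topology (discrete_topology (simplices X n))
                        (subtopology (powertop_real UNIV) (standard_simplex n))) UNIV"

definition glue ::
  "'s sset \<Rightarrow> ((nat \<times> 's \<times> (nat \<Rightarrow> real)) \<times> (nat \<times> 's \<times> (nat \<Rightarrow> real))) set" where
  "glue X =
     {((n, face X n i x, t), (Suc n, x, simplical_face i t)) | n i x t.
         i \<le> Suc n \<and> x \<in> simplices X (Suc n) \<and> t \<in> standard_simplex n} \<union>
     {((Suc n, degen X n i x, t), (n, x, codegeneracy i t)) | n i x t.
         i \<le> n \<and> x \<in> simplices X n \<and> t \<in> standard_simplex (Suc n)}"

definition realization_rel ::
  "'s sset \<Rightarrow> ((nat \<times> 's \<times> (nat \<Rightarrow> real)) \<times> (nat \<times> 's \<times> (nat \<Rightarrow> real))) set" where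
  "realization_rel X =
     (glue X \<union> (glue X)\<inverse>)\<^sup>* \<inter> (topspace (prerealization X) \<times> topspace (prerealization X))"

definition quotient_topology :: "'a topology \<Rightarrow> ('a \<times> 'a) set \<Rightarrow> 'a set topology" where
  "quotient_topology Y R = topology (\<lambda>U. U \<subseteq> topspace Y // R \<and> openin Y (\<Union>U))"

definition realization :: "'s sset \<Rightarrow> (nat \<times> 's \<times> (nat \<Rightarrow> real)) set topology" where
  "realization X = quotient_topology (prerealization X) (realization_rel X)"

definition vertex_point :: "'s sset \<Rightarrow> 's \<Rightarrow> (nat \<times> 's \<times> (nat \<Rightarrow> real)) set" where
  "vertex_point X x = realization_rel X `` {(0, x, (\<lambda>j. if j = 0 then 1 else 0))}"

text \<open>
  For a simplicial subset of \<open>Y\<close>, a point of its realization is an equivalence class, contained in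
  a unique class of the realization of \<open>Y\<close>; this is the map induced by the inclusion.
\<close>

definition realization_inclusion ::
  "'s sset \<Rightarrow> (nat \<times> 's \<times> (nat \<Rightarrow> real)) set \<Rightarrow> (nat \<times> 's \<times> (nat \<Rightarrow> real)) set" where
  "realization_inclusion Y c = realization_rel Y `` c"


section \<open>Homotopy groups\<close>

text \<open>
  Elements of \<open>\<pi>\<^sub>k(Y, y)\<close> are homotopy classes relative to the boundary of maps from the \<open>k\<close>-cube to
  \<open>Y\<close> sending the boundary to \<open>y\<close>.  The \<open>0\<close>-cube is a point with empty boundary, so \<open>\<pi>\<^sub>0(Y, y)\<close>
  is the set of path components.  Triviality of an induced map involves only the
  underlying pointed sets, so the group structure for \<open>k \<ge> 1\<close> is not needed.
\<close>

definition cube :: "nat \<Rightarrow> (nat \<Rightarrow> real) topology" where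
  "cube k = product_topology (\<lambda>i. top_of_set {0..1}) {..<k}"

definition cube_boundary :: "nat \<Rightarrow> (nat \<Rightarrow> real) set" where
  "cube_boundary k = {t \<in> topspace (cube k). \<exists>i<k. t i = 0 \<or> t i = 1}"

definition spheroid :: "nat \<Rightarrow> 'a topology \<Rightarrow> 'a \<Rightarrow> ((nat \<Rightarrow> real) \<Rightarrow> 'a) \<Rightarrow> bool" where
  "spheroid k Y y f \<longleftrightarrow> continuous_map (cube k) Y f \<and> (\<forall>t\<in>cube_boundary k. f t = y)"

definition spheroid_rel ::
  "nat \<Rightarrow> 'a topology \<Rightarrow> 'a \<Rightarrow> (((nat \<Rightarrow> real) \<Rightarrow> 'a) \<times> ((nat \<Rightarrow> real) \<Rightarrow> 'a)) set" where
  "spheroid_rel k Y y =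
     {(f, g). homotopic_with (\<lambda>h. \<forall>t\<in>cube_boundary k. h t = y) (cube k) Y f g}"

definition homotopy_group :: "nat \<Rightarrow> 'a topology \<Rightarrow> 'a \<Rightarrow> ((nat \<Rightarrow> real) \<Rightarrow> 'a) set set" where
  "homotopy_group k Y y = {f. spheroid k Y y f} // spheroid_rel k Y y"

definition homotopy_unit :: "nat \<Rightarrow> 'a topology \<Rightarrow> 'a \<Rightarrow> ((nat \<Rightarrow> real) \<Rightarrow> 'a) set" where
  "homotopy_unit k Y y = spheroid_rel k Y y `` {\<lambda>t. y}"

text \<open>The map induced on \<open>\<pi>\<^sub>k\<close> by \<open>\<phi>\<close>, with values in \<open>\<pi>\<^sub>k(Z, z)\<close>, where \<open>z\<close> is the image of the base point.\<close>

definition homotopy_map ::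
  "nat \<Rightarrow> 'b topology \<Rightarrow> 'b \<Rightarrow> ('a \<Rightarrow> 'b) \<Rightarrow> ((nat \<Rightarrow> real) \<Rightarrow> 'a) set \<Rightarrow> ((nat \<Rightarrow> real) \<Rightarrow> 'b) set" where
  "homotopy_map k Z z \<phi> c = spheroid_rel k Z z `` ((\<lambda>f. \<phi> \<circ> f) ` c)"

definition trivial_on_homotopy :: "nat \<Rightarrow> 's sset \<Rightarrow> 's sset \<Rightarrow> 's \<Rightarrow> bool" where
  "trivial_on_homotopy k X Y x \<longleftrightarrow>
     (\<forall>c\<in>homotopy_group k (realization X) (vertex_point X x).
        homotopy_map k (realization Y) (vertex_point Y x) (realization_inclusion Y) c =
          homotopy_unit k (realization Y) (vertex_point Y x))"


section \<open>Filtrations and essential connectivity\<close>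

definition filtration :: "'s sset \<Rightarrow> 'i::order set \<Rightarrow> ('i \<Rightarrow> 's sset) \<Rightarrow> bool" where
  "filtration X A F \<longleftrightarrow>
     A \<noteq> {} \<and> (\<forall>\<alpha>\<in>A. \<forall>\<beta>\<in>A. \<exists>\<gamma>\<in>A. \<alpha> \<le> \<gamma> \<and> \<beta> \<le> \<gamma>) \<and>
     (\<forall>\<alpha>\<in>A. simplicial_subset (F \<alpha>) X) \<and>
     (\<forall>\<alpha>\<in>A. \<forall>\<beta>\<in>A. \<alpha> \<le> \<beta> \<longrightarrow> simplicial_subset (F \<alpha>) (F \<beta>)) \<and>
     (\<forall>k. (\<Union>\<alpha>\<in>A. simplices (F \<alpha>) k) = simplices X k)"

text \<open>
  The degree is an integer so that degree \<open>-1\<close> is meaningful (and vacuous).  The notion is meant for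
  filtrations of connected simplicial sets; the choice of the vertex is then immaterial.
\<close>

definition essentially_connected ::
  "int \<Rightarrow> 's sset \<Rightarrow> 'i::order set \<Rightarrow> ('i \<Rightarrow> 's sset) \<Rightarrow> bool" where
  "essentially_connected n X A F \<longleftrightarrow>
     (\<exists>x\<in>simplices X 0. \<forall>k::nat. int k \<le> n \<longrightarrow>
        (\<forall>\<alpha>\<in>A. x \<in> simplices (F \<alpha>) 0 \<longrightarrow>
           (\<exists>\<beta>\<in>A. \<alpha> \<le> \<beta> \<and> trivial_on_homotopy k (F \<alpha>) (F \<beta>) x)))"

definition compact_subsets :: "'a topology \<Rightarrow> 'a set set" where
  "compact_subsets T = {C. compactin T C}"

definition type_C :: "nat \<Rightarrow> ('a, 'b) monoid_scheme \<Rightarrow> 'a topology \<Rightarrow> bool" where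
  "type_C n G T \<longleftrightarrow>
     essentially_connected (int n - 1) (E (carrier G)) (compact_subsets T)
       (translates G (carrier G))"

definition Sigma_top :: "nat \<Rightarrow> ('a, 'b) monoid_scheme \<Rightarrow> 'a topology \<Rightarrow> ('a \<Rightarrow> real) set" where
  "Sigma_top n G T =
     {chi. character G T chi \<and>
        essentially_connected (int n - 1) (E (carrier G)) (compact_subsets T)
          (translates G (char_halfspace G chi))}"


section \<open>Well-definedness\<close>

lemma nth_delete_entry:
  "i < length xs \<Longrightarrow> Suc k < length xs \<Longrightarrow> delete_entry i xs ! k = xs ! (if k < i then k else Suc k)"
  by (auto simp: delete_entry_def nth_append)

lemma nth_double_entry:
  assumes "i < length xs" "k \<le> length xs"
  shows "double_entry i xs ! k = xs ! (if k \<le> i then k else k - 1)"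
proof (cases "k \<le> i")
  case True
  with assms show ?thesis by (simp add: double_entry_def nth_append)
next
  case False
  with assms have "i + (k - Suc i) = k - 1" by simp
  with False assms show ?thesis by (simp add: double_entry_def nth_append)
qed

lemma length_delete_entry [simp]: "i < length xs \<Longrightarrow> length (delete_entry i xs) = length xs - 1"
  and length_double_entry [simp]: "i < length xs \<Longrightarrow> length (double_entry i xs) = Suc (length xs)"
  by (auto simp: delete_entry_def double_entry_def)

lemma set_delete_entry: "set (delete_entry i xs) \<subseteq> set xs"
  and set_double_entry: "set (double_entry i xs) \<subseteq> set xs"
  by (auto simp: delete_entry_def double_entry_def dest: in_set_takeD in_set_dropD)

lemma simplicial_set_E: "simplicial_set (E S)"
proof -
  have ext: "xs = ys" if "length xs = n" "length ys = n" "\<And>k. k < n \<Longrightarrow> xs ! k = ys ! k"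
    for xs ys :: "'a list" and n
    using that by (auto intro: nth_equalityI)
  have "delete_entry i (delete_entry j xs) = delete_entry (j - 1) (delete_entry i xs)"
    if "length xs = n + 3" "i < j" "j \<le> n + 2" for i j n and xs :: "'a list"
    by (rule ext[of _ "Suc n"])
       (use that in \<open>auto simp: nth_delete_entry intro!: arg_cong[where f = "nth xs"]\<close>)
  moreover have "double_entry i (double_entry j xs) = double_entry (Suc j) (double_entry i xs)"
    if "length xs = Suc n" "i \<le> j" "j \<le> n" for i j n and xs :: "'a list"
    by (rule ext[of _ "n + 3"])
       (use that in \<open>auto simp: nth_double_entry intro!: arg_cong[where f = "nth xs"]\<close>)
  moreover have "delete_entry i (double_entry j xs) = double_entry (j - 1) (delete_entry i xs)"
    if "length xs = n + 2" "i < j" "j \<le> Suc n" for i j n and xs :: "'a list"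
    by (rule ext[of _ "n + 2"])
       (use that in \<open>auto simp: nth_double_entry nth_delete_entry intro!: arg_cong[where f = "nth xs"]\<close>)
  moreover have "delete_entry i (double_entry i xs) = xs"
    "delete_entry (Suc i) (double_entry i xs) = xs"
    if "length xs = Suc n" "i \<le> n" for i n and xs :: "'a list"
    by (rule ext[of _ "Suc n"],
        use that in \<open>auto simp: nth_double_entry nth_delete_entry intro!: arg_cong[where f = "nth xs"]\<close>)+
  moreover have "delete_entry i (double_entry j xs) = double_entry j (delete_entry (i - 1) xs)"
    if "length xs = n + 2" "Suc j < i" "i \<le> n + 2" for i j n and xs :: "'a list"
    by (rule ext[of _ "n + 2"])
       (use that in \<open>auto simp: nth_double_entry nth_delete_entry intro!: arg_cong[where f = "nth xs"]\<close>)
  moreover have "set (delete_entry i xs) \<subseteq> S" "set (double_entry i xs) \<subseteq> S"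
    if "set xs \<subseteq> S" for i xs
    using that set_delete_entry set_double_entry by fast+
  ultimately show ?thesis
    unfolding simplicial_set_def E_def by (simp add: numeral_3_eq_3)
qed

lemma translates_simps:
  "simplices (translates G H C) n =
     {map (\<lambda>x. g \<otimes>\<^bsub>G\<^esub> x) xs | g xs. g \<in> H \<and> length xs = Suc n \<and> set xs \<subseteq> C}"
  "face (translates G H C) = (\<lambda>n. delete_entry)"
  "degen (translates G H C) = (\<lambda>n. double_entry)"
  by (simp_all add: translates_def E_def)

lemma (in group) filtration_translates:
  assumes T: "topspace T = carrier G" and H: "\<one> \<in> H" "H \<subseteq> carrier G"
  shows "filtration (E (carrier G)) (compact_subsets T) (translates G H)"
proof -
  have *: "simplicial_subset (translates G H C) Y"
    if "face Y = (\<lambda>n. delete_entry)" "degen Y = (\<lambda>n. double_entry)"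
       "\<And>n. simplices (translates G H C) n \<subseteq> simplices Y n" for C Y
  proof -
    have map: "delete_entry i (map f xs) = map f (delete_entry i xs)"
         "double_entry i (map f xs) = map f (double_entry i xs)" for i and f :: "'a \<Rightarrow> 'a" and xs
      by (simp_all add: delete_entry_def double_entry_def take_map drop_map)
    have "delete_entry i xs \<in> simplices (translates G H C) n"
      if "xs \<in> simplices (translates G H C) (Suc n)" "i \<le> Suc n" for i n xs
    proof -
      obtain g ys where "xs = map (\<lambda>x. g \<otimes> x) ys" "g \<in> H" "length ys = Suc (Suc n)" "set ys \<subseteq> C"
        using \<open>xs \<in> _\<close> unfolding translates_simps by blast
      then show ?thesis
        unfolding translates_simps using \<open>i \<le> Suc n\<close> map(1) set_delete_entry[of i ys]
        by (intro CollectI exI[of _ g] exI[of _ "delete_entry i ys"]) auto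
    qed
    moreover have "double_entry i xs \<in> simplices (translates G H C) (Suc n)"
      if "xs \<in> simplices (translates G H C) n" "i \<le> n" for i n xs
    proof -
      obtain g ys where "xs = map (\<lambda>x. g \<otimes> x) ys" "g \<in> H" "length ys = Suc n" "set ys \<subseteq> C"
        using \<open>xs \<in> _\<close> unfolding translates_simps by blast
      then show ?thesis
        unfolding translates_simps using \<open>i \<le> n\<close> map(2) set_double_entry[of i ys]
        by (intro CollectI exI[of _ g] exI[of _ "double_entry i ys"]) auto
    qed
    ultimately show ?thesis
      using that unfolding simplicial_subset_def by (simp add: translates_simps(2,3))
  qed
  have sub: "C \<subseteq> carrier G" if "C \<in> compact_subsets T" for C
    using that T compactin_subset_topspace by (auto simp: compact_subsets_def)
  have sub_E: "simplices (translates G H C) n \<subseteq> simplices (E (carrier G)) n"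
    if "C \<in> compact_subsets T" for C n
  proof
    fix ys assume "ys \<in> simplices (translates G H C) n"
    then obtain g xs where "ys = map (\<lambda>x. g \<otimes> x) xs" "g \<in> H" "length xs = Suc n" "set xs \<subseteq> C"
      unfolding translates_simps by blast
    then show "ys \<in> simplices (E (carrier G)) n"
      using sub[OF that] H(2) by (auto simp: E_def subset_iff)
  qed
  have cover: "xs \<in> (\<Union>C\<in>compact_subsets T. simplices (translates G H C) n)"
    if "xs \<in> simplices (E (carrier G)) n" for xs n
  proof
    show "set xs \<in> compact_subsets T"
      using that T by (simp add: compact_subsets_def E_def finite_imp_compactin)
    have "map (\<lambda>x. \<one> \<otimes> x) xs = xs"
      using that by (intro map_idI) (auto simp: E_def)
    then show "xs \<in> simplices (translates G H (set xs)) n"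
      using that H(1) unfolding translates_simps E_def
      by (intro CollectI exI[of _ "\<one>"] exI[of _ xs]) auto
  qed
  have directed: "\<exists>C''\<in>compact_subsets T. C \<le> C'' \<and> C' \<le> C''"
    if "C \<in> compact_subsets T" "C' \<in> compact_subsets T" for C C'
    using that by (intro bexI[of _ "C \<union> C'"]) (auto simp: compact_subsets_def compactin_Un)
  have empty: "{} \<in> compact_subsets T"
    by (simp add: compact_subsets_def)
  have mono: "simplices (translates G H C) n \<subseteq> simplices (translates G H C') n" if "C \<subseteq> C'" for C C' n
    using that unfolding translates_simps by blast
  show ?thesis
    unfolding filtration_def
  proof (intro conjI ballI impI allI)
    show "compact_subsets T \<noteq> {}"
      using empty by blast
    show "\<exists>C''\<in>compact_subsets T. C \<le> C'' \<and> C' \<le> C''"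
      if "C \<in> compact_subsets T" "C' \<in> compact_subsets T" for C C'
      using directed[OF that] .
    show "simplicial_subset (translates G H C) (E (carrier G))" if "C \<in> compact_subsets T" for C
      using sub_E[OF that] by (intro *) (simp_all add: E_def)
    show "simplicial_subset (translates G H C) (translates G H C')" if "C \<le> C'" for C C'
      using mono[OF that] by (intro *) (simp_all add: translates_simps(2,3))
    show "(\<Union>C\<in>compact_subsets T. simplices (translates G H C) n) = simplices (E (carrier G)) n" for n
      using cover sub_E by blast
  qed
qed

lemma filtration_type_C:
  assumes "topological_group G T"
  shows "filtration (E (carrier G)) (compact_subsets T) (translates G (carrier G))"
proof -
  interpret topological_group G T by fact
  show ?thesis by (rule filtration_translates) (auto simp: topspace_eq)
qed

lemma filtration_Sigma_top:
  assumes "topological_group G T" "character G T chi"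
  shows "filtration (E (carrier G)) (compact_subsets T) (translates G (char_halfspace G chi))"
proof -
  interpret topological_group G T by fact
  have "chi (\<one>\<^bsub>G\<^esub> \<otimes>\<^bsub>G\<^esub> \<one>\<^bsub>G\<^esub>) = chi \<one>\<^bsub>G\<^esub> + chi \<one>\<^bsub>G\<^esub>"
    using assms(2) unfolding character_def by blast
  then have "chi \<one>\<^bsub>G\<^esub> = 0" by simp
  then show ?thesis
    by (intro filtration_translates) (auto simp: topspace_eq char_halfspace_def)
qed

lemma equiv_realization_rel: "equiv (topspace (prerealization X)) (realization_rel X)"
proof -
  have "equiv P ((Q \<union> Q\<inverse>)\<^sup>* \<inter> (P \<times> P))" for P :: "'b set" and Q
  proof (rule equivI)
    show "refl_on P ((Q \<union> Q\<inverse>)\<^sup>* \<inter> (P \<times> P))"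
      by (auto intro: refl_onI)
    have "sym ((Q \<union> Q\<inverse>)\<^sup>*)"
      by (intro sym_rtrancl sym_Un_converse)
    then show "sym ((Q \<union> Q\<inverse>)\<^sup>* \<inter> (P \<times> P))"
      by (auto intro!: symI dest: symD)
    show "trans ((Q \<union> Q\<inverse>)\<^sup>* \<inter> (P \<times> P))"
      by (intro transI) (blast intro: rtrancl_trans)
  qed auto
  then show ?thesis
    unfolding realization_rel_def .
qed

lemma openin_quotient_topology:
  assumes "equiv (topspace Y) R"
  shows "openin (quotient_topology Y R) U \<longleftrightarrow> U \<subseteq> topspace Y // R \<and> openin Y (\<Union>U)"
proof -
  have Int: "\<Union>(U \<inter> V) = \<Union>U \<inter> \<Union>V" if "U \<subseteq> topspace Y // R" "V \<subseteq> topspace Y // R" for U V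
    using that quotient_disj[OF assms] by blast
  have Un: "openin Y (\<Union>(\<Union>\<K>))" if "\<forall>U\<in>\<K>. openin Y (\<Union>U)" for \<K>
  proof -
    have "openin Y (\<Union>U\<in>\<K>. \<Union>U)"
      using that by (intro openin_Union) auto
    moreover have "(\<Union>U\<in>\<K>. \<Union>U) = \<Union>(\<Union>\<K>)"
      by blast
    ultimately show ?thesis by metis
  qed
  have "istopology (\<lambda>U. U \<subseteq> topspace Y // R \<and> openin Y (\<Union>U))"
    unfolding istopology_def
  proof (intro conjI allI impI)
    show "openin Y (\<Union>(U \<inter> V))"
      if "U \<subseteq> topspace Y // R \<and> openin Y (\<Union>U)" "V \<subseteq> topspace Y // R \<and> openin Y (\<Union>V)" for U V
      using that Int[of U V] by (simp only: openin_Int)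
  qed (use Un in blast)+
  then show ?thesis
    by (simp add: quotient_topology_def)
qed

lemma quotient_map_quotient_topology:
  assumes "equiv (topspace Y) R"
  shows "quotient_map Y (quotient_topology Y R) (\<lambda>y. R `` {y})"
proof -
  have Un: "\<Union>(topspace Y // R) = topspace Y"
    using assms by (rule Union_quotient)
  have top: "topspace (quotient_topology Y R) = topspace Y // R"
    using openin_quotient_topology[OF assms] Un
    by (metis openin_subset openin_topspace subset_antisym subset_refl)
  have "{y \<in> topspace Y. R `` {y} \<in> U} = \<Union>U" if "U \<subseteq> topspace Y // R" for U
  proof (intro equalityI subsetI)
    fix y assume "y \<in> {y \<in> topspace Y. R `` {y} \<in> U}"
    then show "y \<in> \<Union>U" using equiv_class_self[OF assms] by blast
  next
    fix y assume "y \<in> \<Union>U"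
    then obtain c where c: "c \<in> U" "y \<in> c" by blast
    with that have "c \<in> topspace Y // R" by blast
    then obtain z where "c = R `` {z}" by (rule quotientE)
    with c have "c = R `` {y}"
      using equiv_class_eq[OF assms, of z y] by simp
    moreover have "y \<in> topspace Y"
      using c \<open>c \<in> topspace Y // R\<close> Un by blast
    ultimately show "y \<in> {y \<in> topspace Y. R `` {y} \<in> U}"
      using c by simp
  qed
  then show ?thesis
    unfolding quotient_map_def top by (auto simp: openin_quotient_topology[OF assms] quotient_def)
qed

end

theory Submission
  imports Defs
begin

text \<open>
  Let \<open>z\<close> be central with \<open>chi z > 0\<close>, let \<open>D\<close> be compact and \<open>\<bar>chi\<bar> \<le> c\<close> on \<open>D\<close>.  Move every vertex
  \<open>v\<close> by the least power \<open>z\<^sup>m\<close> with \<open>m \<ge> 0\<close> and \<open>chi (z\<^sup>m v) \<ge> - c\<close>.  On a simplex with vertices in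
  \<open>g D\<close> these exponents differ by a bounded amount and \<open>z\<close> commutes with \<open>g\<close>, so this is a simplicial
  map from \<open>G \<cdot> E D\<close> to \<open>G\<^sub>\<chi> \<cdot> E D'\<close>, where \<open>D'\<close> is the union of finitely many \<open>z\<^sup>j D\<close>; it fixes
  \<open>G\<^sub>\<chi> \<cdot> E D\<close>.  Composing with it turns a null-homotopy in \<open>G \<cdot> E D\<close> of a spheroid of
  \<open>G\<^sub>\<chi> \<cdot> E C\<close>, with \<open>C \<subseteq> D\<close>, into one in \<open>G\<^sub>\<chi> \<cdot> E D'\<close>.
\<close>

section \<open>Functoriality of the realization\<close>

text \<open>One function serves every degree because simplices of all dimensions share a type; only
  its values on simplices matter.\<close>

definition sset_hom :: "('s \<Rightarrow> 't) \<Rightarrow> 's sset \<Rightarrow> 't sset \<Rightarrow> bool" where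
  "sset_hom \<phi> X Y \<longleftrightarrow>
     (\<forall>n. \<forall>x\<in>simplices X n. \<phi> x \<in> simplices Y n) \<and>
     (\<forall>n. \<forall>i\<le>Suc n. \<forall>x\<in>simplices X (Suc n). \<phi> (face X n i x) = face Y n i (\<phi> x)) \<and>
     (\<forall>n. \<forall>i\<le>n. \<forall>x\<in>simplices X n. \<phi> (degen X n i x) = degen Y n i (\<phi> x))"

definition relabel :: "('s \<Rightarrow> 't) \<Rightarrow> nat \<times> 's \<times> (nat \<Rightarrow> real) \<Rightarrow> nat \<times> 't \<times> (nat \<Rightarrow> real)" where
  "relabel \<phi> = (\<lambda>(n, x, t). (n, \<phi> x, t))"

lemma relabel_apply [simp]: "relabel \<phi> (n, x, t) = (n, \<phi> x, t)"
  by (simp add: relabel_def)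

lemma relabel_id [simp]: "relabel id = id"
  by (auto simp: relabel_def)

text \<open>The relabelled points of a class of \<open>X\<close> need not fill a class of
  \<open>Y\<close>, so they are saturated under \<open>realization_rel Y\<close>. For
  \<open>id\<close> this is \<open>realization_inclusion\<close>, so inclusions and the retraction
  are treated alike.\<close>

definition realization_map ::
  "('s \<Rightarrow> 't) \<Rightarrow> 't sset \<Rightarrow> (nat \<times> 's \<times> (nat \<Rightarrow> real)) set \<Rightarrow> (nat \<times> 't \<times> (nat \<Rightarrow> real)) set" where
  "realization_map \<phi> Y c = realization_rel Y `` (relabel \<phi> ` c)"

lemma realization_inclusion_eq: "realization_inclusion Y = realization_map id Y"
  by (simp add: fun_eq_iff realization_inclusion_def realization_map_def)

lemma topspace_prerealization:
  "(n, x, t) \<in> topspace (prerealization X) \<longleftrightarrow> x \<in> simplices X n \<and> t \<in> standard_simplex n"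
  by (simp add: prerealization_def)

lemma relabel_in_topspace:
  assumes "sset_hom \<phi> X Y" "p \<in> topspace (prerealization X)"
  shows "relabel \<phi> p \<in> topspace (prerealization Y)"
  using assms by (cases p) (auto simp: topspace_prerealization sset_hom_def)

text \<open>\<phi> commutes with faces and degeneracies and coordinates are untouched, so each
  generating relation maps to one of the same kind.\<close>

lemma relabel_glue:
  assumes "sset_hom \<phi> X Y" "(p, q) \<in> glue X"
  shows "(relabel \<phi> p, relabel \<phi> q) \<in> glue Y"
proof -
  consider (face) n i x t where "p = (n, face X n i x, t)" "q = (Suc n, x, simplical_face i t)"
      "i \<le> Suc n" "x \<in> simplices X (Suc n)" "t \<in> standard_simplex n"
    | (degen) n i x t where "p = (Suc n, degen X n i x, t)" "q = (n, x, codegeneracy i t)"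
      "i \<le> n" "x \<in> simplices X n" "t \<in> standard_simplex (Suc n)"
    using assms(2) unfolding glue_def by blast
  then show ?thesis
  proof cases
    case face
    then have "relabel \<phi> p = (n, face Y n i (\<phi> x), t)" "\<phi> x \<in> simplices Y (Suc n)"
      using assms(1) by (simp_all add: sset_hom_def)
    then show ?thesis
      unfolding glue_def using face by simp blast
  next
    case degen
    then have "relabel \<phi> p = (Suc n, degen Y n i (\<phi> x), t)" "\<phi> x \<in> simplices Y n"
      using assms(1) by (simp_all add: sset_hom_def)
    then show ?thesis
      unfolding glue_def using degen by simp blast
  qed
qed

text \<open>Induction along a chain of generating relations; the two ends are treated separately,
  since \<open>realization_rel\<close> restricts to the disjoint union only after taking the
  closure.\<close>

lemma relabel_realization_rel:
  assumes \<phi>: "sset_hom \<phi> X Y" and "(p, q) \<in> realization_rel X"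
  shows "(relabel \<phi> p, relabel \<phi> q) \<in> realization_rel Y"
proof -
  have "(p, q) \<in> (glue X \<union> (glue X)\<inverse>)\<^sup>*"
    using assms(2) by (simp add: realization_rel_def)
  then have "(relabel \<phi> p, relabel \<phi> q) \<in> (glue Y \<union> (glue Y)\<inverse>)\<^sup>*"
  proof induction
    case (step q r)
    then have "(relabel \<phi> q, relabel \<phi> r) \<in> glue Y \<union> (glue Y)\<inverse>"
      using relabel_glue[OF \<phi>] by blast
    with step.IH show ?case by (rule rtrancl_into_rtrancl)
  qed simp
  then show ?thesis
    using assms(2) relabel_in_topspace[OF \<phi>] by (simp add: realization_rel_def)
qed

text \<open>Independence of the representative: any other one relabels to a point equivalent to
  \<open>relabel \<phi> p\<close>, and transitivity absorbs it.\<close>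

lemma realization_map_class:
  assumes \<phi>: "sset_hom \<phi> X Y" and p: "p \<in> topspace (prerealization X)"
  shows "realization_map \<phi> Y (realization_rel X `` {p}) = realization_rel Y `` {relabel \<phi> p}"
proof
  show "realization_map \<phi> Y (realization_rel X `` {p}) \<subseteq> realization_rel Y `` {relabel \<phi> p}"
  proof
    fix r assume "r \<in> realization_map \<phi> Y (realization_rel X `` {p})"
    then obtain q where "(p, q) \<in> realization_rel X" "(relabel \<phi> q, r) \<in> realization_rel Y"
      unfolding realization_map_def by blast
    then have "(relabel \<phi> p, r) \<in> realization_rel Y"
      using relabel_realization_rel[OF \<phi>] equiv_realization_rel[of Y] unfolding equiv_def
      by (blast dest: transD)
    then show "r \<in> realization_rel Y `` {relabel \<phi> p}"
      by simp
  qed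
  have "p \<in> realization_rel X `` {p}"
    using equiv_class_self[OF equiv_realization_rel p] .
  then show "realization_rel Y `` {relabel \<phi> p} \<subseteq> realization_map \<phi> Y (realization_rel X `` {p})"
    unfolding realization_map_def by blast
qed

section \<open>Continuity of maps between realizations\<close>

lemma quotient_map_realization:
  "quotient_map (prerealization X) (realization X) (\<lambda>p. realization_rel X `` {p})"
  unfolding realization_def by (rule quotient_map_quotient_topology[OF equiv_realization_rel])

lemma realization_cases:
  assumes "c \<in> topspace (realization X)"
  obtains p where "p \<in> topspace (prerealization X)" "c = realization_rel X `` {p}"
  using assms quotient_imp_surjective_map[OF quotient_map_realization[of X]] by blast

text \<open>Openness in a disjoint union is tested on each summand, where the map is \<phi> on a
  discrete space times the identity on the standard simplex.\<close>

lemma continuous_map_relabel: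
  assumes \<phi>: "sset_hom \<phi> X Y"
  shows "continuous_map (prerealization X) (prerealization Y) (relabel \<phi>)"
  unfolding continuous_map_def
proof (intro conjI allI impI)
  show "relabel \<phi> \<in> topspace (prerealization X) \<rightarrow> topspace (prerealization Y)"
    using relabel_in_topspace[OF \<phi>] by blast
  fix U assume U: "openin (prerealization Y) U"
  let ?P = "\<lambda>X n. prod_topology (discrete_topology (simplices X n))
                   (subtopology (powertop_real UNIV) (standard_simplex n))"
  have "openin (?P X n) {q. (n, q) \<in> {p \<in> topspace (prerealization X). relabel \<phi> p \<in> U}}" for n
  proof -
    have "continuous_map (discrete_topology (simplices X n)) (discrete_topology (simplices Y n)) \<phi>"
      using \<phi> by (auto simp: sset_hom_def)
    then have "continuous_map (?P X n) (?P Y n) (\<lambda>(x, t). (\<phi> x, t))"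
      using continuous_map_prod_top[where g = "\<lambda>t. t"] continuous_map_id[unfolded id_def] by blast
    moreover have "openin (?P Y n) {q. (n, q) \<in> U}"
      using U by (simp add: prerealization_def openin_sum_topology)
    ultimately have "openin (?P X n) {q \<in> topspace (?P X n). (\<lambda>(x, t). (\<phi> x, t)) q \<in> {q. (n, q) \<in> U}}"
      by (rule openin_continuous_map_preimage)
    moreover have "{q \<in> topspace (?P X n). (\<lambda>(x, t). (\<phi> x, t)) q \<in> {q. (n, q) \<in> U}} =
        {q. (n, q) \<in> {p \<in> topspace (prerealization X). relabel \<phi> p \<in> U}}"
      by (auto simp: topspace_prerealization)
    ultimately show ?thesis by simp
  qed
  moreover have "{p \<in> topspace (prerealization X). relabel \<phi> p \<in> U} \<subseteq> Sigma UNIV (topspace \<circ> ?P X)"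
    by (auto simp: topspace_prerealization)
  ultimately show "openin (prerealization X) {p \<in> topspace (prerealization X). relabel \<phi> p \<in> U}"
    by (subst prerealization_def, subst openin_sum_topology) blast
qed

lemma continuous_map_realization_map:
  assumes \<phi>: "sset_hom \<phi> X Y"
  shows "continuous_map (realization X) (realization Y) (realization_map \<phi> Y)"
proof (rule continuous_compose_quotient_map[OF quotient_map_realization])
  have "continuous_map (prerealization X) (realization Y)
          ((\<lambda>p. realization_rel Y `` {p}) \<circ> relabel \<phi>)"
    using continuous_map_compose[OF continuous_map_relabel[OF \<phi>]
        quotient_imp_continuous_map[OF quotient_map_realization]] .
  then show "continuous_map (prerealization X) (realization Y)
          (realization_map \<phi> Y \<circ> (\<lambda>p. realization_rel X `` {p}))"
    by (rule continuous_map_eq) (simp add: realization_map_class[OF \<phi>])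
qed

text \<open>A third map \<theta> stands for the composite because the functions may agree on
  simplices of \<open>X\<close> only; this is how a retraction gets replaced by
  \<open>id\<close>.\<close>

lemma realization_map_comp:
  assumes \<phi>: "sset_hom \<phi> X Y" and \<psi>: "sset_hom \<psi> Y Z" and \<theta>: "sset_hom \<theta> X Z"
    and eq: "\<And>n x. x \<in> simplices X n \<Longrightarrow> \<psi> (\<phi> x) = \<theta> x"
    and c: "c \<in> topspace (realization X)"
  shows "realization_map \<psi> Z (realization_map \<phi> Y c) = realization_map \<theta> Z c"
proof -
  obtain p where p: "p \<in> topspace (prerealization X)" "c = realization_rel X `` {p}"
    using c by (rule realization_cases)
  have "relabel \<psi> (relabel \<phi> p) = relabel \<theta> p"
    using p(1) eq by (cases p) (auto simp: topspace_prerealization)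
  then show ?thesis
    using p relabel_in_topspace[OF \<phi>]
    by (simp add: realization_map_class[OF \<phi>] realization_map_class[OF \<psi>] realization_map_class[OF \<theta>])
qed

lemma vertex_in_prerealization:
  assumes "x \<in> simplices X 0"
  shows "(0, x, \<lambda>j. if j = 0 then 1 else 0) \<in> topspace (prerealization X)"
  using assms by (simp add: topspace_prerealization standard_simplex_def)

lemma realization_map_vertex_point:
  assumes "sset_hom \<phi> X Y" "x \<in> simplices X 0"
  shows "realization_map \<phi> Y (vertex_point X x) = vertex_point Y (\<phi> x)"
  unfolding vertex_point_def
  using realization_map_class[OF assms(1) vertex_in_prerealization[OF assms(2)]] by simp


section \<open>Triviality on homotopy groups\<close>

text \<open>Reflexivity is kept apart, since it holds for spheroids only.\<close>

lemma spheroid_rel_sym_trans: "sym (spheroid_rel k Y y)" "trans (spheroid_rel k Y y)"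
  unfolding spheroid_rel_def
  by (intro symI; simp add: homotopic_with_sym) (intro transI; simp; rule homotopic_with_trans)

lemma spheroid_rel_refl: "spheroid k Y y f \<Longrightarrow> (f, f) \<in> spheroid_rel k Y y"
  by (simp add: spheroid_def spheroid_rel_def)

lemma spheroid_rel_class_eq:
  "(f, g) \<in> spheroid_rel k Y y \<Longrightarrow> spheroid_rel k Y y `` {f} = spheroid_rel k Y y `` {g}"
  using spheroid_rel_sym_trans[of k Y y] by (blast dest: symD transD)

lemma spheroid_rel_spheroid:
  assumes "(f, g) \<in> spheroid_rel k Y y"
  shows "spheroid k Y y g"
proof -
  have hom: "homotopic_with (\<lambda>h. \<forall>t\<in>cube_boundary k. h t = y) (cube k) Y f g"
    using assms by (simp add: spheroid_rel_def)
  show ?thesis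
    using homotopic_with_imp_continuous_maps[OF hom] homotopic_with_imp_property[OF hom]
    by (simp add: spheroid_def)
qed

lemma spheroid_compose:
  "spheroid k Y y f \<Longrightarrow> continuous_map Y Z h \<Longrightarrow> h y = z \<Longrightarrow> spheroid k Z z (h \<circ> f)"
  by (auto simp: spheroid_def intro: continuous_map_compose)

lemma spheroid_rel_compose:
  assumes "(f, g) \<in> spheroid_rel k Y y" "continuous_map Y Z h" "h y = z"
  shows "(h \<circ> f, h \<circ> g) \<in> spheroid_rel k Z z"
proof -
  have "homotopic_with (\<lambda>h. \<forall>t\<in>cube_boundary k. h t = y) (cube k) Y f g"
    using assms(1) by (simp add: spheroid_rel_def)
  then have "homotopic_with (\<lambda>h. \<forall>t\<in>cube_boundary k. h t = z) (cube k) Z (h \<circ> f) (h \<circ> g)"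
    by (rule homotopic_with_compose_continuous_map_left[OF _ assms(2)]) (simp add: assms(3))
  then show ?thesis
    by (simp add: spheroid_rel_def)
qed

text \<open>Trades homotopy classes for single spheroids, so that null-homotopies can be composed
  with maps.\<close>

lemma trivial_on_homotopy_iff:
  assumes j: "sset_hom id X Y" and x: "x \<in> simplices X 0"
  shows "trivial_on_homotopy k X Y x \<longleftrightarrow>
    (\<forall>f. spheroid k (realization X) (vertex_point X x) f \<longrightarrow>
       (realization_inclusion Y \<circ> f, \<lambda>t. vertex_point Y x)
         \<in> spheroid_rel k (realization Y) (vertex_point Y x))"
    (is "?L \<longleftrightarrow> ?R")
proof -
  let ?X = "realization X" and ?Y = "realization Y"
  let ?x = "vertex_point X x" and ?y = "vertex_point Y x"
  let ?RX = "spheroid_rel k ?X ?x" and ?RY = "spheroid_rel k ?Y ?y"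
  let ?j = "realization_inclusion Y"
  have cj: "continuous_map ?X ?Y ?j" and jx: "?j ?x = ?y"
    using continuous_map_realization_map[OF j] realization_map_vertex_point[OF j x]
    by (simp_all add: realization_inclusion_eq)
  show ?thesis
  proof (intro iffI allI impI)
    fix f assume L: ?L and f: "spheroid k ?X ?x f"
    have "?RX `` {f} \<in> homotopy_group k ?X ?x"
      unfolding homotopy_group_def using f by (auto intro: quotientI)
    with L have "homotopy_map k ?Y ?y ?j (?RX `` {f}) = homotopy_unit k ?Y ?y"
      by (simp add: trivial_on_homotopy_def)
    moreover have "?j \<circ> f \<in> homotopy_map k ?Y ?y ?j (?RX `` {f})"
      unfolding homotopy_map_def
      using spheroid_rel_refl[OF f] spheroid_rel_refl[OF spheroid_compose[OF f cj jx]] by blast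
    ultimately show "(?j \<circ> f, \<lambda>t. ?y) \<in> ?RY"
      using spheroid_rel_sym_trans(1)[of k ?Y ?y] unfolding homotopy_unit_def by (blast dest: symD)
  next
    assume R: ?R
    show ?L
      unfolding trivial_on_homotopy_def
    proof
      fix c assume "c \<in> homotopy_group k ?X ?x"
      then obtain f where f: "spheroid k ?X ?x f" and c: "c = ?RX `` {f}"
        unfolding homotopy_group_def by (auto elim: quotientE)
      have "?RY `` {?j \<circ> g} = homotopy_unit k ?Y ?y" if "g \<in> c" for g
      proof -
        have "spheroid k ?X ?x g"
          using that unfolding c by (auto intro: spheroid_rel_spheroid)
        then show ?thesis
          unfolding homotopy_unit_def using R by (intro spheroid_rel_class_eq) simp
      qed
      \<comment> \<open>\<open>homotopy_map\<close> is a union over the members of \<open>c\<close>,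
        each giving the unit class; a member is needed to rule out the empty union.\<close>
      moreover have "f \<in> c"
        using spheroid_rel_refl[OF f] c by blast
      ultimately show "homotopy_map k ?Y ?y ?j c = homotopy_unit k ?Y ?y"
        unfolding homotopy_map_def by blast
    qed
  qed
qed

text \<open>A spheroid of \<open>W\<close>, viewed in \<open>X\<close>, becomes null-homotopic in
  \<open>Y\<close>; \<rho> carries the null-homotopy into \<open>Z\<close>, and on \<open>W\<close>
  the way through \<open>Y\<close> is just the inclusion into \<open>Z\<close>.\<close>

lemma trivial_on_homotopy_transfer:
  assumes triv: "trivial_on_homotopy k X Y x"
    and WX: "sset_hom id W X" and XY: "sset_hom id X Y" and WZ: "sset_hom id W Z"
    and \<rho>: "sset_hom \<rho> Y Z" and fix_W: "\<And>n w. w \<in> simplices W n \<Longrightarrow> \<rho> w = w"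
    and x: "x \<in> simplices W 0"
  shows "trivial_on_homotopy k W Z x"
  unfolding trivial_on_homotopy_iff[OF WZ x]
proof (intro allI impI)
  fix f assume f: "spheroid k (realization W) (vertex_point W x) f"
  let ?i = "realization_map id X" and ?j = "realization_map id Y" and ?r = "realization_map \<rho> Z"
  let ?y = "vertex_point Y x" and ?z = "vertex_point Z x"
  let ?RZ = "spheroid_rel k (realization Z) ?z"
  have xX: "x \<in> simplices X 0" and xY: "x \<in> simplices Y 0"
    using WX XY x by (auto simp: sset_hom_def)
  have "spheroid k (realization X) (vertex_point X x) (?i \<circ> f)"
    using f continuous_map_realization_map[OF WX] realization_map_vertex_point[OF WX x]
    by (intro spheroid_compose) auto
  then have "(?j \<circ> (?i \<circ> f), \<lambda>t. ?y) \<in> spheroid_rel k (realization Y) ?y"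
    using triv by (simp add: trivial_on_homotopy_iff[OF XY xX] realization_inclusion_eq)
  moreover have ry: "?r ?y = ?z"
    using realization_map_vertex_point[OF \<rho> xY] fix_W[OF x] by simp
  ultimately have "(?r \<circ> (?j \<circ> (?i \<circ> f)), ?r \<circ> (\<lambda>t. ?y)) \<in> ?RZ"
    using continuous_map_realization_map[OF \<rho>] by (intro spheroid_rel_compose)
  then have *: "homotopic_with (\<lambda>h. \<forall>t\<in>cube_boundary k. h t = ?z) (cube k) (realization Z)
      (?r \<circ> (?j \<circ> (?i \<circ> f))) (?r \<circ> (\<lambda>t. ?y))"
    by (simp add: spheroid_rel_def)
  have WY: "sset_hom id W Y"
    using WX XY by (auto simp: sset_hom_def)
  have eq: "?r (?j (?i c)) = realization_map id Z c" if "c \<in> topspace (realization W)" for c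
    using realization_map_comp[OF WX XY WY _ that] realization_map_comp[OF WY \<rho> WZ _ that] fix_W
    by simp
  have ft: "f t \<in> topspace (realization W)" if "t \<in> topspace (cube k)" for t
    using f that continuous_map_image_subset_topspace unfolding spheroid_def by blast
  \<comment> \<open>Agreement on the cube, whose points \<open>f\<close> sends into the realization
    of \<open>W\<close>, suffices to exchange the maps.\<close>
  have "homotopic_with (\<lambda>h. \<forall>t\<in>cube_boundary k. h t = ?z) (cube k) (realization Z)
      (realization_map id Z \<circ> f) (\<lambda>t. ?z)"
    by (rule homotopic_with_eq[OF *])
       (use eq ft ry in \<open>auto simp: cube_boundary_def\<close>)
  then show "(realization_inclusion Z \<circ> f, \<lambda>t. ?z) \<in> ?RZ"
    by (simp add: spheroid_rel_def realization_inclusion_eq)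
qed


section \<open>Characters and central elements\<close>

text \<open>Keeps inverses and all integer powers of a central element in the center.\<close>

lemma (in group) subgroup_group_center: "subgroup (group_center G) G"
proof (rule subgroupI)
  show "inv a \<in> group_center G" if "a \<in> group_center G" for a
  proof -
    have a: "a \<in> carrier G" "\<And>g. g \<in> carrier G \<Longrightarrow> a \<otimes> g = g \<otimes> a"
      using that by (auto simp: group_center_def)
    have "inv a \<otimes> g = g \<otimes> inv a" if g: "g \<in> carrier G" for g
    proof -
      have "inv a \<otimes> g = inv a \<otimes> (g \<otimes> a) \<otimes> inv a"
        using a(1) g by (simp add: m_assoc)
      also have "\<dots> = inv a \<otimes> (a \<otimes> g) \<otimes> inv a"
        using a(2)[OF g] by simp
      also have "\<dots> = g \<otimes> inv a"
        using a(1) g by (simp flip: m_assoc)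
      finally show ?thesis .
    qed
    then show ?thesis
      using a(1) unfolding group_center_def by blast
  qed
  show "a \<otimes> b \<in> group_center G" if "a \<in> group_center G" "b \<in> group_center G" for a b
  proof -
    have ab: "a \<in> carrier G" "b \<in> carrier G"
      and comm: "\<And>g. g \<in> carrier G \<Longrightarrow> a \<otimes> g = g \<otimes> a" "\<And>g. g \<in> carrier G \<Longrightarrow> b \<otimes> g = g \<otimes> b"
      using that unfolding group_center_def by blast+
    have "a \<otimes> b \<otimes> g = g \<otimes> (a \<otimes> b)" if "g \<in> carrier G" for g
    proof -
      have "a \<otimes> b \<otimes> g = a \<otimes> (g \<otimes> b)"
        using ab that comm(2)[OF that] by (simp add: m_assoc)
      also have "\<dots> = g \<otimes> a \<otimes> b"
        using ab that comm(1)[OF that] by (simp flip: m_assoc)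
      finally show ?thesis
        using ab that by (simp add: m_assoc)
    qed
    then show ?thesis
      using ab unfolding group_center_def by blast
  qed
next
  show "group_center G \<noteq> {}"
    using one_closed r_one l_one unfolding group_center_def by fastforce
qed (simp add: group_center_def Collect_mono_iff subset_iff)

lemma (in group) character_one: "character G T chi \<Longrightarrow> chi \<one> = 0"
  unfolding character_def by (metis add_cancel_right_right one_closed r_one)

lemma (in group) character_inv:
  "character G T chi \<Longrightarrow> a \<in> carrier G \<Longrightarrow> chi (inv a) = - chi a"
  using character_one[of T chi] r_inv[of a] inv_closed[of a]
  unfolding character_def by (metis add_eq_0_iff)

lemma (in group) character_int_pow:
  assumes chi: "character G T chi" and a: "a \<in> carrier G"
  shows "chi (a [^] (i::int)) = of_int i * chi a"
proof (induction i rule: int_induct[where k = 0])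
  case base
  show ?case using character_one[OF chi] by simp
next
  case (step1 i)
  have "chi (a [^] i \<otimes> a) = chi (a [^] i) + chi a"
    using chi a by (simp add: character_def)
  with step1 show ?case
    using int_pow_mult[OF a, of i 1] a by (simp add: algebra_simps)
next
  case (step2 i)
  have "chi (a [^] i \<otimes> inv a) = chi (a [^] i) + chi (inv a)"
    using chi a by (simp add: character_def)
  with step2 show ?case
    using int_pow_mult[OF a, of i "-1"] a character_inv[OF chi a]
    by (simp add: int_pow_neg algebra_simps)
qed

section \<open>Compact sets: translates and bounds for characters\<close>

lemma (in topological_group) compactin_left_translate:
  assumes "g \<in> carrier G" "compactin T D"
  shows "compactin T ((\<lambda>x. g \<otimes> x) ` D)"
proof -
  have "continuous_map T (prod_topology T T) (\<lambda>x. (g, x))"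
    using assms(1) by (simp add: continuous_map_pairwise o_def topspace_eq)
  then have "continuous_map T T ((\<lambda>(x, y). x \<otimes> y) \<circ> (\<lambda>x. (g, x)))"
    using continuous_mult by (rule continuous_map_compose)
  then show ?thesis
    using image_compactin[OF assms(2)] by (simp add: o_def)
qed

lemma character_bounded_on_compact:
  assumes "character G T chi" "compactin T D"
  obtains c where "0 \<le> c" "\<And>x. x \<in> D \<Longrightarrow> \<bar>chi x\<bar> \<le> c"
proof -
  have "compact (chi ` D)"
    using assms image_compactin[of T D euclideanreal chi] by (simp add: character_def)
  then obtain c where "\<And>x. x \<in> D \<Longrightarrow> \<bar>chi x\<bar> \<le> c"
    using compact_imp_bounded bounded_iff by (metis imageI real_norm_def)
  \<comment> \<open>For empty \<open>D\<close> the bound could be negative, hence the maximum with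
    0.\<close>
  then have "\<bar>chi x\<bar> \<le> max 0 c" if "x \<in> D" for x
    using that by (simp add: le_max_iff_disj)
  then show thesis
    using that[of "max 0 c"] by simp
qed

section \<open>Simplicial maps between sets of translates\<close>

text \<open>Entrywise application commutes with deleting and doubling entries, so only preservation
  of simplices is left to check.\<close>

lemma sset_hom_map_translates:
  assumes "\<And>n xs. xs \<in> simplices (translates G H C) n \<Longrightarrow> map \<rho> xs \<in> simplices (translates G H' C') n"
  shows "sset_hom (map \<rho>) (translates G H C) (translates G H' C')"
  using assms
  by (auto simp: sset_hom_def translates_simps(2,3) delete_entry_def double_entry_def take_map drop_map)

lemma sset_hom_id_translates:
  assumes "H \<subseteq> H'" "C \<subseteq> C'"
  shows "sset_hom id (translates G H C) (translates G H' C')"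
proof -
  have "simplices (translates G H C) n \<subseteq> simplices (translates G H' C') n" for n
    unfolding translates_simps using assms by blast
  then show ?thesis
    using sset_hom_map_translates[where \<rho> = id] by (metis list.map_id subsetD list.map_id0)
qed

text \<open>One exponent \<open>a\<close> is used for a whole simplex: \<open>\<rho> (g \<otimes> y)
  = (z [^] a \<otimes> g) \<otimes> (z [^] j \<otimes> y)\<close> with
  \<open>j = m (g \<otimes> y) - a\<close>. A suitable \<open>a\<close> puts the first factor into
  the half-space and confines \<open>j\<close> to a finite range independent of
  \<open>g\<close>.\<close>

lemma (in topological_group) central_retraction:
  assumes chi: "character G T chi" and z: "z \<in> group_center G" "0 < chi z"
    and D: "compactin T D"
  obtains D' \<rho> where "compactin T D'" "D \<subseteq> D'"
    "sset_hom (map \<rho>) (translates G (carrier G) D) (translates G (char_halfspace G chi) D')"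
    "\<And>n xs. xs \<in> simplices (translates G (char_halfspace G chi) D) n \<Longrightarrow> map \<rho> xs = xs"
proof -
  obtain c where c: "0 \<le> c" "\<And>x. x \<in> D \<Longrightarrow> \<bar>chi x\<bar> \<le> c"
    using character_bounded_on_compact[OF chi D] by blast
  have DG: "D \<subseteq> carrier G"
    using D compactin_subset_topspace topspace_eq by blast
  have zc: "z [^] (i::int) \<in> group_center G" for i
    by (rule subgroup_int_pow_closed[OF subgroup_group_center z(1)])
  then have zG: "z [^] (i::int) \<in> carrier G" and zcomm: "g \<in> carrier G \<Longrightarrow> z [^] i \<otimes> g = g \<otimes> z [^] i"
    for i g unfolding group_center_def by blast+
  have z0: "z \<in> carrier G"
    using z(1) unfolding group_center_def by blast
  have chi_mult: "chi (a \<otimes> b) = chi a + chi b" if "a \<in> carrier G" "b \<in> carrier G" for a b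
    using chi that by (simp add: character_def)
  have chi_pow: "chi (z [^] (i::int)) = of_int i * chi z" for i
    using character_int_pow[OF chi z0] .
  \<comment> \<open>The inequality \<open>chi v + m * chi z \<ge> - c\<close> solved for
    \<open>m\<close> and rounded up; the cut-off at 0 leaves vertices already satisfying it in
    place.\<close>
  define m :: "'a \<Rightarrow> int" where "m v = max 0 \<lceil>(- c - chi v) / chi z\<rceil>" for v
  define \<rho> where "\<rho> v = z [^] m v \<otimes> v" for v
  \<comment> \<open>Serves twice: \<open>N\<close> bounds the difference of exponents within a
    simplex, and \<open>N\<close> further factors \<open>z\<close> raise \<open>chi\<close> by more
    than \<open>2 * c\<close>.\<close>
  define N where "N = \<lceil>2 * c / chi z\<rceil> + 1"
  \<comment> \<open>Exponents differ by at most \<open>N\<close> from that of a reference vertex;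
    subtracting a further \<open>N\<close> gives this range.\<close>
  define D' where "D' = (\<Union>j\<in>{- 2 * N..0}. (\<lambda>x. z [^] j \<otimes> x) ` D)"
  have N: "2 * c \<le> of_int N * chi z - chi z" "0 \<le> N"
  proof -
    have "2 * c / chi z \<le> of_int N - 1"
      by (simp add: N_def)
    then have "2 * c \<le> (of_int N - 1) * chi z"
      using z(2) by (simp only: pos_divide_le_eq)
    then show "2 * c \<le> of_int N * chi z - chi z"
      by (simp add: left_diff_distrib)
    show "0 \<le> N"
      using c(1) z(2) divide_nonneg_pos[of "2 * c" "chi z"] unfolding N_def by linarith
  qed
  have m_lower: "- c \<le> chi v + of_int (m v) * chi z" for v
  proof -
    have "(- c - chi v) / chi z \<le> of_int (m v)"
      unfolding m_def by linarith
    then show ?thesis using z(2) by (simp add: field_simps)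
  qed
  have m_diff: "\<bar>m v - m w\<bar> \<le> N" if "\<bar>chi v - chi w\<bar> \<le> 2 * c" for v w
  proof -
    \<comment> \<open>Subadditivity of the ceiling; if the cut-off gives \<open>m v = 0\<close>,
      then \<open>N \<ge> 0\<close> suffices. The other sign follows by symmetry.\<close>
    have "m v - m w \<le> N" if "chi w - chi v \<le> 2 * c" for v w
    proof -
      have "(- c - chi v) / chi z \<le> (- c - chi w) / chi z + 2 * c / chi z"
        using that z(2) unfolding add_divide_distrib[symmetric] by (intro divide_right_mono) auto
      then show ?thesis
        unfolding m_def N_def using c(1) z(2) divide_nonneg_pos[of "2 * c" "chi z"] by linarith
    qed
    from this[of w v] this[of v w] that show ?thesis by linarith
  qed
  have "map \<rho> xs \<in> simplices (translates G (char_halfspace G chi) D') n"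
    if "xs \<in> simplices (translates G (carrier G) D) n" for n xs
  proof -
    obtain g ys where xs: "xs = map (\<lambda>x. g \<otimes> x) ys" and g: "g \<in> carrier G"
      and ys: "length ys = Suc n" "set ys \<subseteq> D"
      using \<open>xs \<in> _\<close> unfolding translates_simps by blast
    define y0 where "y0 = hd ys"
    have y0: "y0 \<in> D"
      using ys unfolding y0_def by (metis hd_in_set length_0_conv nat.distinct(1) subsetD)
    define a where "a = m (g \<otimes> y0) + N"
    define h where "h = z [^] a \<otimes> g"
    have "chi (g \<otimes> y0) = chi g + chi y0"
      using g y0 DG by (intro chi_mult) auto
    \<comment> \<open>\<open>m_lower\<close> and \<open>chi y0 \<le> c\<close> give
      \<open>chi g + m (g \<otimes> y0) * chi z \<ge> - 2 * c\<close>; the summand \<open>N\<close>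
      in \<open>a\<close> makes up the deficit.\<close>
    then have "0 \<le> chi g + of_int a * chi z"
      using m_lower[of "g \<otimes> y0"] c(2)[OF y0] N z(2) by (simp add: a_def distrib_right abs_le_iff)
    then have h: "h \<in> char_halfspace G chi"
      using g zG by (simp add: char_halfspace_def h_def chi_mult chi_pow)
    have "\<exists>y'\<in>D'. \<rho> (g \<otimes> y) = h \<otimes> y'" if y: "y \<in> set ys" for y
    proof -
      have yD: "y \<in> D" "y \<in> carrier G"
        using y ys DG by auto
      define j where "j = m (g \<otimes> y) - a"
      \<comment> \<open>\<open>chi g\<close> cancels, so the spread over the simplex is at most that
        of \<open>chi\<close> on \<open>D\<close>.\<close>
      have "\<bar>chi (g \<otimes> y) - chi (g \<otimes> y0)\<bar> \<le> 2 * c"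
        using c(2)[OF y0] c(2)[OF yD(1)] g yD y0 DG by (subst (1 2) chi_mult) (auto simp: abs_le_iff)
      then have "j \<in> {- 2 * N..0}"
        using m_diff by (fastforce simp: j_def a_def abs_le_iff)
      then have "z [^] j \<otimes> y \<in> D'"
        using yD(1) unfolding D'_def by blast
      moreover have "h \<otimes> (z [^] j \<otimes> y) = \<rho> (g \<otimes> y)"
      proof -
        have "h \<otimes> (z [^] j \<otimes> y) = z [^] a \<otimes> (g \<otimes> z [^] j) \<otimes> y"
          using g yD zG by (simp add: h_def m_assoc)
        \<comment> \<open>Centrality enters here: powers of \<open>z\<close> move past
          \<open>g\<close>.\<close>
        also have "\<dots> = z [^] a \<otimes> (z [^] j \<otimes> g) \<otimes> y"
          using zcomm[OF g, of j] by simp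
        also have "\<dots> = (z [^] a \<otimes> z [^] j) \<otimes> (g \<otimes> y)"
          using g yD zG by (simp add: m_assoc)
        also have "z [^] a \<otimes> z [^] j = z [^] m (g \<otimes> y)"
          using int_pow_mult[OF z0, of a j] by (simp add: j_def)
        finally show ?thesis by (simp add: \<rho>_def)
      qed
      ultimately show ?thesis by metis
    qed
    then obtain f where f: "\<And>y. y \<in> set ys \<Longrightarrow> f y \<in> D' \<and> \<rho> (g \<otimes> y) = h \<otimes> f y"
      by metis
    have "map \<rho> xs = map (\<lambda>x. h \<otimes> x) (map f ys)" "length (map f ys) = Suc n" "set (map f ys) \<subseteq> D'"
      using f ys by (auto simp: xs)
    with h show ?thesis
      unfolding translates_simps by blast
  qed
  then have hom: "sset_hom (map \<rho>) (translates G (carrier G) D) (translates G (char_halfspace G chi) D')"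
    by (rule sset_hom_map_translates)
  have fixed: "map \<rho> xs = xs" if "xs \<in> simplices (translates G (char_halfspace G chi) D) n" for n xs
  proof -
    obtain g ys where xs: "xs = map (\<lambda>x. g \<otimes> x) ys" and "g \<in> char_halfspace G chi"
      and ys: "set ys \<subseteq> D"
      using \<open>xs \<in> _\<close> unfolding translates_simps by blast
    then have g: "g \<in> carrier G" "0 \<le> chi g"
      by (simp_all add: char_halfspace_def)
    have "\<rho> (g \<otimes> y) = g \<otimes> y" if y: "y \<in> set ys" for y
    proof -
      have yD: "y \<in> D" "y \<in> carrier G" using y ys DG by auto
      \<comment> \<open>As \<open>chi g \<ge> 0\<close>, translating by \<open>g\<close> cannot push
        \<open>y\<close> below \<open>- c\<close>, so the cut-off makes the exponent exactly
        0.\<close>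
      have "- c \<le> chi (g \<otimes> y)"
        using c(2)[OF yD(1)] g yD by (simp add: chi_mult abs_le_iff)
      then have "(- c - chi (g \<otimes> y)) / chi z \<le> 0"
        using z(2) by (intro divide_nonpos_pos) auto
      then have "m (g \<otimes> y) = 0"
        by (simp add: m_def ceiling_le_iff)
      then show ?thesis using g yD by (simp add: \<rho>_def)
    qed
    then show ?thesis by (simp add: xs)
  qed
  have "compactin T D'"
    unfolding D'_def using compactin_left_translate[OF zG D] by (intro compactin_Union) auto
  moreover have "D \<subseteq> D'"
  proof
    fix x assume "x \<in> D"
    moreover have "z [^] (0::int) \<otimes> x = x" "(0::int) \<in> {- 2 * N..0}"
      using \<open>x \<in> D\<close> DG N(2) by auto
    ultimately show "x \<in> D'"
      unfolding D'_def by (metis (no_types, lifting) UN_I imageI)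
  qed
  ultimately show thesis
    using that hom fixed by blast
qed

section \<open>From type C to the half-space filtration\<close>

theorem theorem7:
  fixes G :: "('a, 'b) monoid_scheme" and T :: "'a topology" and n :: nat
  assumes "topological_group G T"
    and "locally_compact_space T"
    and "Hausdorff_space T"
    and "type_C n G T"
  shows "{chi. character G T chi \<and> (\<exists>z\<in>group_center G. chi z \<noteq> 0)} \<subseteq> Sigma_top n G T"
proof
  interpret topological_group G T by fact
  fix chi assume "chi \<in> {chi. character G T chi \<and> (\<exists>z\<in>group_center G. chi z \<noteq> 0)}"
  then obtain w where chi: "character G T chi" and w: "w \<in> group_center G" "chi w \<noteq> 0"
    by blast
  \<comment> \<open>If \<open>chi w\<close> is negative, the inverse of \<open>w\<close> is central
    with positive value.\<close>
  obtain z where z: "z \<in> group_center G" "0 < chi z"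
  proof (cases "0 < chi w")
    case False
    moreover have "chi (inv\<^bsub>G\<^esub> w) = - chi w"
      using w(1) by (intro character_inv[OF chi]) (simp add: group_center_def)
    ultimately show ?thesis
      using that[of "inv\<^bsub>G\<^esub> w"] w subgroup.m_inv_closed[OF subgroup_group_center] by simp
  qed (use w that in blast)
  let ?K = "compact_subsets T" and ?H = "char_halfspace G chi"
  have H: "?H \<subseteq> carrier G"
    by (auto simp: char_halfspace_def)
  \<comment> \<open>The vertex supplied by type C serves for the half-space filtration as
    well.\<close>
  obtain x where x: "x \<in> simplices (E (carrier G)) 0"
    and triv: "\<And>k C. int k \<le> int n - 1 \<Longrightarrow> C \<in> ?K \<Longrightarrow> x \<in> simplices (translates G (carrier G) C) 0 \<Longrightarrow>
      \<exists>D\<in>?K. C \<subseteq> D \<and> trivial_on_homotopy k (translates G (carrier G) C) (translates G (carrier G) D) x"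
    using assms(4) unfolding type_C_def essentially_connected_def by blast
  have "\<exists>D'\<in>?K. C \<subseteq> D' \<and> trivial_on_homotopy k (translates G ?H C) (translates G ?H D') x"
    if k: "int k \<le> int n - 1" and C: "C \<in> ?K" and xC: "x \<in> simplices (translates G ?H C) 0" for k C
  proof -
    have WX: "sset_hom id (translates G ?H C) (translates G (carrier G) C)"
      using H by (rule sset_hom_id_translates) simp
    have "x \<in> simplices (translates G (carrier G) C) 0"
      using WX xC by (simp add: sset_hom_def)
    then obtain D where D: "D \<in> ?K" "C \<subseteq> D"
      and t: "trivial_on_homotopy k (translates G (carrier G) C) (translates G (carrier G) D) x"
      using triv[OF k C] by blast
    obtain D' \<rho> where D': "compactin T D'" "D \<subseteq> D'"
      and hom: "sset_hom (map \<rho>) (translates G (carrier G) D) (translates G ?H D')"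
      and fixed: "\<And>n xs. xs \<in> simplices (translates G ?H D) n \<Longrightarrow> map \<rho> xs = xs"
      using central_retraction[OF chi z, of D] D(1) unfolding compact_subsets_def by blast
    have "trivial_on_homotopy k (translates G ?H C) (translates G ?H D') x"
    \<comment> \<open>Here \<open>W\<close> and \<open>X\<close> are the half-space and full
      translates over \<open>C\<close>, \<open>Y\<close> the full translates over \<open>D\<close>,
      and \<open>Z\<close> the half-space translates over \<open>D'\<close>.\<close>
    proof (rule trivial_on_homotopy_transfer[OF t WX _ _ hom _ xC])
      show "sset_hom id (translates G (carrier G) C) (translates G (carrier G) D)"
        using D(2) by (intro sset_hom_id_translates) auto
      show "sset_hom id (translates G ?H C) (translates G ?H D')"
        using D(2) D'(2) by (intro sset_hom_id_translates) auto
      have "sset_hom id (translates G ?H C) (translates G ?H D)"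
        using D(2) by (intro sset_hom_id_translates) auto
      then show "map \<rho> v = v" if "v \<in> simplices (translates G ?H C) i" for i v
        using that fixed[of v i] by (simp add: sset_hom_def)
    qed
    with D(2) D' show ?thesis
      unfolding compact_subsets_def by blast
  qed
  then show "chi \<in> Sigma_top n G T"
    unfolding Sigma_top_def essentially_connected_def
    using chi x by (intro CollectI conjI bexI[of _ x]) simp_all
qed

end
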